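(* Let $a,b,c,\alpha,\beta\in\mathbb{R}$ be constants with $a\beta^2-b\alpha\beta+c\alpha^2\neq 0$. Let $U\subset\mathbb{R}^2$ be a nonempty connected open set and $f:U\to\mathbb{R}$ a smooth function such that $\alpha f+\beta$ vanishes nowhere on $U$ and $f$ satisfies the Clairaut equation $$y=x f+\frac{a f^2+b f+c}{\alpha f+\beta}\qquad\text{on } U.$$ Then the differential equation $y'=f(x,y)$ admits a 2-dimensional Lie subgroup of $A(2,\mathbb{R})$ and can be transformed to the equation $y'=x-(x^2-2y)^{1/2}$ (on $\{x^2-2y>0\}$) by an element of $A(2,\mathbb{R})$.
   Context: $A(2,\mathbb{R})$ is the group of invertible affine transformations of $\mathbb{R}^2$. An equation $y'=f(x,y)$ with $f$ smooth on a connected open set $U\subset\mathbb{R}^2$ is identified with the Pfaffian system $\langle dy-f\,dx\rangle$, i.e. with the line field $\ell_f(p)=\ker(dy-f\,dx)_p$, $p\in U$. The equation $y'=f$ admits a Lie subgroup $H\subset A(2,\mathbb{R})$ if $dh_p(\ell_f(p))=\ell_f(h(p))$ for all $h\in H$ and all $p\in U$ with $h(p)\in U$. The equation $y'=f$ on $U$ can be transformed to $y'=F$ on $U'$ by an element of $A(2,\mathbb{R})$ if for each $p\in U$ there are a neighbourhood $V\subset U$ of $p$ and $g\in A(2,\mathbb{R})$ with $g(V)\subset U'$ and $dg_q(\ell_f(q))=\ell_F(g(q))$ for all $q\in V$. *)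

theory Defs
  imports "HOL-Analysis.Analysis" "HOL-Algebra.Group"
begin

section \<open>Smooth maps\<close>

text \<open>Intended for open \<open>S\<close> in a finite-dimensional space, where \<^term>\<open>at x\<close> only sees values
  of \<open>f\<close> inside \<open>S\<close>. There it is equivalent to \<open>f\<close> being of class \<open>C\<^sup>k\<close>: all directional derivatives
  are again of class \<open>C\<^sup>k\<^sup>-\<^sup>1\<close>.\<close>

primrec Ck_on :: "nat \<Rightarrow> 'a::real_normed_vector set \<Rightarrow> ('a \<Rightarrow> 'b::real_normed_vector) \<Rightarrow> bool" where
  "Ck_on 0 S f \<longleftrightarrow> continuous_on S f"
| "Ck_on (Suc k) S f \<longleftrightarrow>
     (\<forall>x\<in>S. f differentiable (at x)) \<and>
     (\<forall>v. Ck_on k S (\<lambda>x. frechet_derivative f (at x) v))"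

definition smooth_on :: "'a::real_normed_vector set \<Rightarrow> ('a \<Rightarrow> 'b::real_normed_vector) \<Rightarrow> bool" where
  "smooth_on S f \<longleftrightarrow> (\<forall>k. Ck_on k S f)"


section \<open>Smooth manifolds and Lie groups\<close>

text \<open>A smooth structure on the underlying set of a topology \<open>T\<close> is given by a set of local
  parametrizations (inverse charts) \<open>(W, \<phi>)\<close>, where \<open>\<phi>\<close> maps the open subset \<open>W\<close> of the model
  space \<open>'m\<close> homeomorphically onto an open subset of \<open>T\<close>. The dimension of the manifold is
  \<open>DIM('m)\<close>.\<close>

type_synonym ('m, 'g) atlas = "('m set \<times> ('m \<Rightarrow> 'g)) set"

definition smooth_atlas :: "'g topology \<Rightarrow> ('m::euclidean_space, 'g) atlas \<Rightarrow> bool" where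
  "smooth_atlas T \<A> \<longleftrightarrow>
     (\<forall>(W, \<phi>)\<in>\<A>. open W \<and> openin T (\<phi> ` W) \<and>
        homeomorphic_map (top_of_set W) (subtopology T (\<phi> ` W)) \<phi>) \<and>
     (\<Union>(W, \<phi>)\<in>\<A>. \<phi> ` W) = topspace T \<and>
     (\<forall>(W, \<phi>)\<in>\<A>. \<forall>(W', \<phi>')\<in>\<A>.
        smooth_on {s \<in> W. \<phi> s \<in> \<phi>' ` W'} (inv_into W' \<phi>' \<circ> \<phi>))"

definition smooth_manifold :: "'g topology \<Rightarrow> ('m::euclidean_space, 'g) atlas \<Rightarrow> bool" where
  "smooth_manifold T \<A> \<longleftrightarrow> Hausdorff_space T \<and> second_countable T \<and> smooth_atlas T \<A>"

definition prod_atlas :: "('m, 'g) atlas \<Rightarrow> ('n, 'h) atlas \<Rightarrow> ('m \<times> 'n, 'g \<times> 'h) atlas" where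
  "prod_atlas \<A> \<B> = {(W \<times> Z, map_prod \<phi> \<psi>) | W \<phi> Z \<psi>. (W, \<phi>) \<in> \<A> \<and> (Z, \<psi>) \<in> \<B>}"

definition smooth_manifold_map ::
  "'g topology \<Rightarrow> ('m::euclidean_space, 'g) atlas \<Rightarrow>
   'h topology \<Rightarrow> ('n::euclidean_space, 'h) atlas \<Rightarrow> ('g \<Rightarrow> 'h) \<Rightarrow> bool" where
  "smooth_manifold_map T \<A> T' \<B> F \<longleftrightarrow>
     continuous_map T T' F \<and>
     (\<forall>(W, \<phi>)\<in>\<A>. \<forall>(Z, \<psi>)\<in>\<B>.
        smooth_on {s \<in> W. F (\<phi> s) \<in> \<psi> ` Z} (inv_into Z \<psi> \<circ> F \<circ> \<phi>))"

definition lie_group ::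
  "('g, 'x) monoid_scheme \<Rightarrow> 'g topology \<Rightarrow> ('m::euclidean_space, 'g) atlas \<Rightarrow> bool" where
  "lie_group G T \<A> \<longleftrightarrow>
     group G \<and> topspace T = carrier G \<and> smooth_manifold T \<A> \<and>
     smooth_manifold_map (prod_topology T T) (prod_atlas \<A> \<A>) T \<A> (\<lambda>(x, y). x \<otimes>\<^bsub>G\<^esub> y) \<and>
     smooth_manifold_map T \<A> T \<A> (\<lambda>x. inv\<^bsub>G\<^esub> x)"


section \<open>The group of invertible affine transformations of the plane\<close>

text \<open>The pair \<open>(A, v)\<close> stands for the transformation \<open>p \<mapsto> A p + v\<close>. As a manifold the group is an open
  subset of the six-dimensional vector space of all pairs.\<close>

type_synonym aff = "(real^2^2) \<times> (real^2)"

definition aff_map :: "aff \<Rightarrow> real^2 \<Rightarrow> real^2" where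
  "aff_map g p = fst g *v p + snd g"

definition A2 :: "aff monoid" where
  "A2 = \<lparr>carrier = {g. invertible (fst g)},
         mult = (\<lambda>g h. (fst g ** fst h, fst g *v snd h + snd g)),
         one = (mat 1, 0)\<rparr>"

lemma aff_map_mult: "aff_map (g \<otimes>\<^bsub>A2\<^esub> h) = aff_map g \<circ> aff_map h"
  by (rule ext) (simp add: A2_def aff_map_def matrix_vector_right_distrib matrix_vector_mul_assoc)

lemma aff_map_one: "aff_map \<one>\<^bsub>A2\<^esub> = id"
  by (rule ext) (simp add: A2_def aff_map_def)

lemma inj_aff_map: "inj aff_map"
proof (rule injI)
  fix g h :: aff assume eq: "aff_map g = aff_map h"
  have s: "snd g = snd h"
    using fun_cong[OF eq, of 0] by (simp add: aff_map_def)
  have "fst g *v p = fst h *v p" for p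
    using fun_cong[OF eq, of p] s by (simp add: aff_map_def)
  then have "fst g = fst h" by (simp add: matrix_eq)
  with s show "g = h" by (simp add: prod_eq_iff)
qed

lemma group_A2: "group A2"
proof (rule groupI)
  fix x y z assume "x \<in> carrier A2" "y \<in> carrier A2" "z \<in> carrier A2"
  show "x \<otimes>\<^bsub>A2\<^esub> y \<otimes>\<^bsub>A2\<^esub> z = x \<otimes>\<^bsub>A2\<^esub> (y \<otimes>\<^bsub>A2\<^esub> z)"
    by (rule injD[OF inj_aff_map]) (simp add: aff_map_mult o_assoc)
next
  fix x assume "x \<in> carrier A2"
  then have "invertible (fst x)" by (simp add: A2_def)
  then obtain B where B: "B ** fst x = mat 1" "fst x ** B = mat 1"
    by (auto simp: invertible_def)
  then have "invertible B" by (auto simp: invertible_def)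
  then show "\<exists>y\<in>carrier A2. y \<otimes>\<^bsub>A2\<^esub> x = \<one>\<^bsub>A2\<^esub>"
    using B by (intro bexI[of _ "(B, - (B *v snd x))"]) (simp_all add: A2_def)
qed (auto simp: A2_def invertible_mult, auto simp: invertible_def)

text \<open>Lie subgroups are, as usual, subgroups with a Lie group structure of their own whose inclusion is
  an immersion; they need not be closed. Since the ambient group is open in a vector
  space, the inclusion is expressed in a chart simply by \<open>\<phi>\<close> itself. The argument of type
  \<open>'m itself\<close> fixes the dimension \<open>DIM('m)\<close>.\<close>

definition lie_subgroup_A2 :: "'m::euclidean_space itself \<Rightarrow> aff set \<Rightarrow> bool" where
  "lie_subgroup_A2 _ H \<longleftrightarrow>
     subgroup H A2 \<and>
     (\<exists>T (\<A> :: ('m, aff) atlas).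
        lie_group (A2\<lparr>carrier := H\<rparr>) T \<A> \<and>
        (\<forall>(W, \<phi>)\<in>\<A>. smooth_on W \<phi> \<and> (\<forall>s\<in>W. inj (frechet_derivative \<phi> (at s)))))"


section \<open>Equations y' = f(x,y) under affine transformations\<close>

text \<open>The point \<open>p\<close> has coordinates \<open>x = p $ 1\<close> and \<open>y = p $ 2\<close>; the line at \<open>p\<close> is the kernel of
  \<open>dy - f dx\<close>.\<close>

definition line_field :: "(real^2 \<Rightarrow> real) \<Rightarrow> real^2 \<Rightarrow> (real^2) set" where
  "line_field f p = {v. v $ 2 - f p * v $ 1 = 0}"

definition admits :: "(real^2) set \<Rightarrow> (real^2 \<Rightarrow> real) \<Rightarrow> aff set \<Rightarrow> bool" where
  "admits U f H \<longleftrightarrow>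
     (\<forall>h\<in>H. \<forall>p\<in>U. aff_map h p \<in> U \<longrightarrow>
        frechet_derivative (aff_map h) (at p) ` line_field f p = line_field f (aff_map h p))"

definition transformable ::
  "(real^2) set \<Rightarrow> (real^2 \<Rightarrow> real) \<Rightarrow> (real^2) set \<Rightarrow> (real^2 \<Rightarrow> real) \<Rightarrow> bool" where
  "transformable U f U' F \<longleftrightarrow>
     (\<forall>p\<in>U. \<exists>V. \<exists>g\<in>carrier A2. open V \<and> p \<in> V \<and> V \<subseteq> U \<and> aff_map g ` V \<subseteq> U' \<and>
        (\<forall>q\<in>V. frechet_derivative (aff_map g) (at q) ` line_field f q
                = line_field F (aff_map g q)))"

end

theory Submission
  imports Defs
begin

text \<open>The Clairaut equation says that the integral curves are straight lines, the tangents of a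
  parabola; there are two of them through each point outside the parabola, and \<open>f\<close> selects one.
  Differentiability of \<open>f\<close> keeps \<open>U\<close> away from the parabola, so by connectedness the selection is the
  same throughout \<open>U\<close>, and a single affine map, possibly followed by the reflection \<open>x \<mapsto> - x\<close>, sends the
  parabola to \<open>x\<^sup>2 = 2y\<close> and \<open>f\<close> to the smaller of the two slopes. The maps
  \<open>(x, y) \<mapsto> (l x + m, l\<^sup>2 y + l m x + m\<^sup>2/2)\<close> with \<open>l > 0\<close> preserve the parabola and send the tangent of
  slope \<open>t\<close> to that of slope \<open>l t + m\<close>, hence preserve the smaller slope; the required subgroup is
  conjugate to the group of these maps.\<close>

section \<open>Calculus of \<open>C\<^sup>k\<close> maps\<close>

text \<open>Since \<open>S\<close> is open, the derivative at a point of \<open>S\<close> depends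
  only on values inside \<open>S\<close>. The derivatives of \<open>f\<close> and \<open>g\<close>
  therefore agree on \<open>S\<close> as well, and the induction passes to them.\<close>

lemma Ck_on_cong:
  assumes "open S" "\<And>x. x \<in> S \<Longrightarrow> f x = g x" "Ck_on k S f"
  shows "Ck_on k S g"
  using assms(2,3)
proof (induction k arbitrary: f g)
  case 0
  then show ?case by (simp cong: continuous_on_cong)
next
  case (Suc k)
  have d: "(g has_derivative frechet_derivative f (at x)) (at x)" if "x \<in> S" for x
  proof (rule has_derivative_transform_within_open[OF _ assms(1) that])
    show "(f has_derivative frechet_derivative f (at x)) (at x)"
      using Suc.prems(2) that by (simp add: frechet_derivative_works[symmetric])
  qed (use Suc.prems(1) in auto)
  have "Ck_on k S (\<lambda>x. frechet_derivative g (at x) v)" for v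
  proof (rule Suc.IH)
    show "Ck_on k S (\<lambda>x. frechet_derivative f (at x) v)"
      using Suc.prems(2) by simp
    show "frechet_derivative f (at x) v = frechet_derivative g (at x) v" if "x \<in> S" for x
      using frechet_derivative_at[OF d[OF that]] by simp
  qed
  then show ?case using d by (auto simp: differentiable_def)
qed

text \<open>This allows an explicit derivative \<open>f'\<close> in place of
  \<open>frechet_derivative\<close>, so that each closure property below reduces to a
  differentiation rule and induction.\<close>

lemma Ck_on_SucI:
  assumes "open S" "\<And>x. x \<in> S \<Longrightarrow> (f has_derivative f' x) (at x)"
    and "\<And>v. Ck_on k S (\<lambda>x. f' x v)"
  shows "Ck_on (Suc k) S f"
proof -
  have "Ck_on k S (\<lambda>x. frechet_derivative f (at x) v)" for v
    by (rule Ck_on_cong[OF assms(1) _ assms(3)[of v]])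
      (use frechet_derivative_at[OF assms(2)] in auto)
  then show ?thesis using assms(2) by (auto simp: differentiable_def)
qed

lemma Ck_on_SucD:
  assumes "Ck_on (Suc k) S f"
  shows "x \<in> S \<Longrightarrow> (f has_derivative frechet_derivative f (at x)) (at x)"
    and "Ck_on k S (\<lambda>x. frechet_derivative f (at x) v)"
  using assms by (simp_all add: frechet_derivative_works[symmetric])

text \<open>The product and chain rules leave undifferentiated factors in the derivative; this
  lowers their order to match that of the differentiated ones.\<close>

lemma Ck_on_lower:
  assumes "Ck_on (Suc k) S f"
  shows "Ck_on k S f"
  using assms
proof (induction k arbitrary: f)
  case 0
  then show ?case
    by (auto intro!: continuous_at_imp_continuous_on differentiable_imp_continuous_within)
next
  case (Suc k)
  have "Ck_on k S (\<lambda>x. frechet_derivative f (at x) v)" for v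
    by (rule Suc.IH) (rule Ck_on_SucD(2)[OF Suc.prems])
  then show ?case
    using Ck_on_SucD(1)[OF Suc.prems] by (auto simp: differentiable_def)
qed

lemma Ck_on_const: "open S \<Longrightarrow> Ck_on k S (\<lambda>x. c)"
proof (induction k arbitrary: c)
  case (Suc k)
  show ?case by (rule Ck_on_SucI[OF Suc.prems has_derivative_const]) (rule Suc.IH[OF Suc.prems])
qed simp

lemma Ck_on_bounded_linear:
  assumes "bounded_linear L" "open S" "Ck_on k S f"
  shows "Ck_on k S (\<lambda>x. L (f x))"
  using assms(3)
proof (induction k arbitrary: f)
  case 0
  then show ?case by (simp add: bounded_linear.continuous_on[OF assms(1)])
next
  case (Suc k)
  show ?case
    by (rule Ck_on_SucI[OF assms(2) bounded_linear.has_derivative[OF assms(1) Ck_on_SucD(1)]])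
      (use Suc in \<open>auto simp del: Ck_on.simps intro: Ck_on_SucD(2)\<close>)
qed

lemma Ck_on_id: "open S \<Longrightarrow> Ck_on k S (\<lambda>x. x)"
proof (cases k)
  case (Suc j)
  assume "open S"
  then show ?thesis unfolding Suc
    by (intro Ck_on_SucI[OF _ has_derivative_ident] Ck_on_const)
qed simp

lemma Ck_on_add:
  assumes "open S" "Ck_on k S f" "Ck_on k S g"
  shows "Ck_on k S (\<lambda>x. f x + g x)"
  using assms(2,3)
proof (induction k arbitrary: f g)
  case 0
  then show ?case by (simp add: continuous_on_add)
next
  case (Suc k)
  show ?case
    by (rule Ck_on_SucI[OF assms(1) has_derivative_add[OF Ck_on_SucD(1) Ck_on_SucD(1)]])
      (use Suc in \<open>auto simp del: Ck_on.simps intro: Ck_on_SucD(2)\<close>)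
qed

lemma Ck_on_sum:
  assumes "open S" "\<And>i. i \<in> I \<Longrightarrow> Ck_on k S (f i)"
  shows "Ck_on k S (\<lambda>x. \<Sum>i\<in>I. f i x)"
  using assms(2) by (induction I rule: infinite_finite_induct)
    (auto intro: Ck_on_const[OF assms(1)] Ck_on_add[OF assms(1)])

text \<open>By the Leibniz rule the derivative is a sum of two values of \<open>B\<close>, each with
  one argument differentiated, so the induction hypothesis applies to both terms.\<close>

lemma Ck_on_bilinear:
  assumes "bounded_bilinear B" "open S" "Ck_on k S f" "Ck_on k S g"
  shows "Ck_on k S (\<lambda>x. B (f x) (g x))"
  using assms(3,4)
proof (induction k arbitrary: f g)
  case 0
  then show ?case by (simp add: bounded_bilinear.continuous_on[OF assms(1)])
next
  case (Suc k)
  show ?case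
    by (rule Ck_on_SucI[OF assms(2)
          bounded_bilinear.FDERIV[OF assms(1) Ck_on_SucD(1) Ck_on_SucD(1)]])
      (use Suc in \<open>auto simp del: Ck_on.simps intro!: Ck_on_add[OF assms(2)] Suc.IH
         intro: Ck_on_SucD(2) Ck_on_lower\<close>)
qed

lemma Ck_on_exp:
  fixes f :: "'a::real_normed_vector \<Rightarrow> real"
  assumes "open S" "Ck_on k S f"
  shows "Ck_on k S (\<lambda>x. exp (f x))"
  using assms(2)
proof (induction k arbitrary: f)
  case 0
  then show ?case by (simp add: continuous_on_exp)
next
  case (Suc k)
  show ?case
    by (rule Ck_on_SucI[OF assms(1) has_derivative_exp[OF Ck_on_SucD(1)]])
      (use Suc in \<open>auto simp del: Ck_on.simps intro!: Ck_on_bilinear[OF bounded_bilinear_mult assms(1)]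
         intro: Ck_on_SucD(2) Ck_on_lower\<close>)
qed

lemma bounded_linear_axis: "bounded_linear (axis i :: 'b::real_normed_vector \<Rightarrow> 'b^'n)"
proof (rule bounded_linear_intro)
  show "norm (axis i x :: 'b^'n) \<le> norm x * 1" for x
    by (simp add: norm_vec_def axis_def L2_set_def if_distrib[of norm]
        if_distrib[of "\<lambda>x. x ^ 2"] cong: if_cong)
qed (auto simp: vec_eq_iff axis_def)

text \<open>A vector-valued map is a finite sum of linear images of its components.\<close>

lemma Ck_on_vec:
  fixes f :: "'a::real_normed_vector \<Rightarrow> 'b::real_normed_vector ^ 'n"
  assumes "open S" "\<And>i. Ck_on k S (\<lambda>x. f x $ i)"
  shows "Ck_on k S f"
proof -
  have "f = (\<lambda>x. \<Sum>i\<in>UNIV. axis i (f x $ i))"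
    by (auto simp: fun_eq_iff vec_eq_iff axis_def)
  moreover have "Ck_on k S (\<lambda>x. \<Sum>i\<in>UNIV. axis i (f x $ i))"
    by (intro Ck_on_sum assms Ck_on_bounded_linear[OF bounded_linear_axis])
  ultimately show ?thesis by simp
qed

lemma Ck_on_vector_2:
  assumes "open S" "Ck_on k S f" "Ck_on k S g"
  shows "Ck_on k S (\<lambda>x. vector [f x, g x] :: 'b::real_normed_vector ^ 2)"
proof (rule Ck_on_vec[OF assms(1)])
  have "\<forall>i. Ck_on k S (\<lambda>x. (vector [f x, g x] :: 'b ^ 2) $ i)"
    using assms by (simp add: forall_2)
  then show "Ck_on k S (\<lambda>x. (vector [f x, g x] :: 'b ^ 2) $ i)" for i ..
qed

lemma Ck_on_Pair:
  assumes "open S" "Ck_on k S f" "Ck_on k S g"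
  shows "Ck_on k S (\<lambda>x. (f x, g x))"
proof -
  have 1: "bounded_linear (\<lambda>x. (x, 0))" and 2: "bounded_linear (\<lambda>x. (0, x))"
    by (intro bounded_linear_Pair bounded_linear_ident bounded_linear_zero)+
  have "Ck_on k S (\<lambda>x. (f x, 0) + (0, g x))"
    by (intro Ck_on_add assms Ck_on_bounded_linear[OF 1] Ck_on_bounded_linear[OF 2])
  then show ?thesis by simp
qed

text \<open>These rules cover the coordinate formulas of the symmetry group below, which for this
  reason are written with sums, products, negation and \<open>exp\<close> only, without powers or
  quotients.\<close>

lemmas Ck_on_intros =
  Ck_on_const Ck_on_id Ck_on_add Ck_on_exp Ck_on_Pair
  Ck_on_bilinear[OF bounded_bilinear_mult]
  Ck_on_bounded_linear[OF bounded_linear_vec_nth]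
  Ck_on_bounded_linear[OF bounded_linear_fst]
  Ck_on_bounded_linear[OF bounded_linear_snd]
  Ck_on_bounded_linear[OF bounded_linear_minus[OF bounded_linear_ident]]

lemma smooth_on_imp_continuous_on: "smooth_on S f \<Longrightarrow> continuous_on S f"
  unfolding smooth_on_def by (metis Ck_on.simps(1))

lemma smooth_on_imp_has_derivative:
  assumes "smooth_on S f" "x \<in> S"
  shows "(f has_derivative frechet_derivative f (at x)) (at x)"
  using assms Ck_on_SucD(1) unfolding smooth_on_def by blast

section \<open>Lie groups with a global chart\<close>

lemma second_countable_euclidean:
  "second_countable (euclidean :: 'a::second_countable_topology topology)"
proof -
  obtain \<B> :: "'a set set" where "countable \<B>" "topological_basis \<B>"
    using ex_countable_basis by blast
  then show ?thesis
    unfolding second_countable_def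
    by (metis open_openin topological_basisE topological_basis_open)
qed

text \<open>Carrying the topology of the model space over along \<open>\<phi>\<close> makes
  \<open>\<phi>\<close> a homeomorphism by construction; the group gets a topology of its own in
  this way.\<close>

lemma homeomorphic_map_pullback_topology:
  assumes "inj \<phi>"
  shows "homeomorphic_map euclidean (pullback_topology (range \<phi>) (inv_into UNIV \<phi>) euclidean) \<phi>"
proof -
  have "continuous_map euclidean (pullback_topology (range \<phi>) (inv_into UNIV \<phi>) euclidean) \<phi>"
    using assms by (intro continuous_map_pullback') (auto simp: o_def)
  moreover have "continuous_map (pullback_topology (range \<phi>) (inv_into UNIV \<phi>) euclidean)
      euclidean (inv_into UNIV \<phi>)"
    using continuous_map_pullback[OF continuous_map_id] by (simp add: o_def id_def)
  ultimately show ?thesis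
    using assms unfolding homeomorphic_map_maps homeomorphic_maps_def
    by (intro exI[of _ "inv_into UNIV \<phi>"]) (auto simp: topspace_pullback_topology f_inv_into_f)
qed

text \<open>One chart covers the group, so the only transition map is the identity, and smoothness
  of the group operations becomes smoothness of their coordinate expressions \<open>m\<close> and
  \<open>i\<close>.\<close>

lemma lie_group_global_chart:
  fixes \<phi> :: "'m::euclidean_space \<Rightarrow> 'g" and G :: "('g, 'x) monoid_scheme"
  assumes G: "group G" and inj: "inj \<phi>" and carrier: "carrier G = range \<phi>"
    and mult: "\<And>s t. \<phi> s \<otimes>\<^bsub>G\<^esub> \<phi> t = \<phi> (m (s, t))" and m: "smooth_on UNIV m"
    and inverse: "\<And>s. inv\<^bsub>G\<^esub> \<phi> s = \<phi> (i s)" and i: "smooth_on UNIV i"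
  shows "\<exists>T. lie_group G T {(UNIV, \<phi>)}"
proof
  let ?T = "pullback_topology (range \<phi>) (inv_into UNIV \<phi>) euclidean"
  have hom: "homeomorphic_map euclidean ?T \<phi>"
    by (rule homeomorphic_map_pullback_topology[OF inj])
  then have space: "(euclidean :: 'm topology) homeomorphic_space ?T"
    by (rule homeomorphic_map_imp_homeomorphic_space)
  have T: "topspace ?T = range \<phi>"
    by (auto simp: topspace_pullback_topology)
  have c: "continuous_map euclidean ?T \<phi>"
    using hom by (rule homeomorphic_imp_continuous_map)
  have c': "continuous_map ?T euclidean (inv_into UNIV \<phi>)"
    using continuous_map_pullback[OF continuous_map_id] by (simp add: o_def id_def)
  have sid: "smooth_on UNIV (\<lambda>x::'m. x)"
    by (simp add: smooth_on_def Ck_on_id)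
  have inv: "inv_into UNIV \<phi> (\<phi> s) = s" for s using inj by simp
  have "Hausdorff_space ?T"
    using homeomorphic_Hausdorff_space[OF space] by (simp add: Hausdorff_space_euclidean)
  moreover have "second_countable ?T"
    using homeomorphic_space_second_countability[OF space] second_countable_euclidean by blast
  moreover have "smooth_atlas ?T {(UNIV, \<phi>)}"
    unfolding smooth_atlas_def using hom sid
    by (auto simp: T o_def inv subtopology_topspace[of ?T, unfolded T]
        openin_topspace[of ?T, unfolded T])
  moreover have "smooth_manifold_map (prod_topology ?T ?T) (prod_atlas {(UNIV, \<phi>)} {(UNIV, \<phi>)})
     ?T {(UNIV, \<phi>)} (\<lambda>(x, y). x \<otimes>\<^bsub>G\<^esub> y)"
  proof -
    have "continuous_map (prod_topology ?T ?T) ?T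
        (\<lambda>z. \<phi> (m (inv_into UNIV \<phi> (fst z), inv_into UNIV \<phi> (snd z))))"
    proof (rule continuous_map_compose[OF _ c, unfolded o_def])
      have m': "continuous_map euclidean euclidean m"
        using smooth_on_imp_continuous_on[OF m] by simp
      have "continuous_map (prod_topology ?T ?T) (prod_topology euclidean euclidean)
          (\<lambda>z. (inv_into UNIV \<phi> (fst z), inv_into UNIV \<phi> (snd z)))"
        by (intro continuous_map_pairedI continuous_map_compose[OF _ c', unfolded o_def]
            continuous_map_fst continuous_map_snd)
      then show "continuous_map (prod_topology ?T ?T) euclidean
          (\<lambda>z. m (inv_into UNIV \<phi> (fst z), inv_into UNIV \<phi> (snd z)))"
        using continuous_map_compose[OF _ m', unfolded o_def] by simp
    qed
    then have "continuous_map (prod_topology ?T ?T) ?T (\<lambda>(x, y). x \<otimes>\<^bsub>G\<^esub> y)"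
      by (rule continuous_map_eq) (auto simp: T mult inv)
    then show ?thesis
      using m unfolding smooth_manifold_map_def prod_atlas_def
      by (auto simp: o_def mult inv map_prod_def case_prod_unfold)
  qed
  moreover have "smooth_manifold_map ?T {(UNIV, \<phi>)} ?T {(UNIV, \<phi>)} (\<lambda>x. inv\<^bsub>G\<^esub> x)"
  proof -
    have "continuous_map ?T ?T (\<lambda>x. \<phi> (i (inv_into UNIV \<phi> x)))"
      using smooth_on_imp_continuous_on[OF i]
      by (intro continuous_map_compose[OF _ c, unfolded o_def]
            continuous_map_compose[OF c', unfolded o_def]) simp
    then have "continuous_map ?T ?T (\<lambda>x. inv\<^bsub>G\<^esub> x)"
      by (rule continuous_map_eq) (auto simp: T inverse inv)
    then show ?thesis
      using i unfolding smooth_manifold_map_def by (auto simp: o_def inverse inv)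
  qed
  ultimately show "lie_group G ?T {(UNIV, \<phi>)}"
    unfolding lie_group_def smooth_manifold_def using G by (simp add: T carrier)
qed

text \<open>Closure under the group operations is read off from the formulas for \<open>m\<close>
  and \<open>i\<close>; the inverse taken in the subgroup is the one taken in
  \<open>A2\<close>.\<close>

lemma lie_subgroup_A2_global_chart:
  fixes \<phi> :: "'m::euclidean_space \<Rightarrow> aff"
  assumes inj: "inj \<phi>" and range: "range \<phi> \<subseteq> carrier A2"
    and mult: "\<And>s t. \<phi> s \<otimes>\<^bsub>A2\<^esub> \<phi> t = \<phi> (m (s, t))" and m: "smooth_on UNIV m"
    and inverse: "\<And>s. inv\<^bsub>A2\<^esub> \<phi> s = \<phi> (i s)" and i: "smooth_on UNIV i"
    and smooth: "smooth_on UNIV \<phi>" and immersion: "\<And>s. inj (frechet_derivative \<phi> (at s))"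
  shows "lie_subgroup_A2 TYPE('m) (range \<phi>)"
proof -
  interpret A2: group A2 by (rule group_A2)
  have sub: "subgroup (range \<phi>) A2"
    using range by (intro A2.subgroupI) (auto simp: mult inverse)
  have "\<exists>T. lie_group (A2\<lparr>carrier := range \<phi>\<rparr>) T {(UNIV, \<phi>)}"
  proof (rule lie_group_global_chart[OF _ inj _ _ m _ i])
    show "group (A2\<lparr>carrier := range \<phi>\<rparr>)"
      by (rule subgroup.subgroup_is_group[OF sub group_A2])
    show "inv\<^bsub>A2\<lparr>carrier := range \<phi>\<rparr>\<^esub> \<phi> s = \<phi> (i s)" for s
      using A2.m_inv_consistent[OF sub, of "\<phi> s"] by (simp add: inverse)
  qed (simp_all add: mult)
  then show ?thesis
    unfolding lie_subgroup_A2_def using sub smooth immersion by blast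
qed

section \<open>The Clairaut equation\<close>

text \<open>In terms of the basis \<open>u = \<alpha> p + \<beta>\<close>, \<open>v = \<alpha> - \<beta> p\<close> of the affine functions of \<open>p\<close>, the Clairaut
  equation is a quadratic form in \<open>u\<close> and \<open>v\<close> in which \<open>v\<^sup>2\<close> has a constant nonzero coefficient. Division
  by \<open>u\<^sup>2\<close> turns it into the equation for the slope \<open>t = v / u\<close> of a tangent of the standard
  parabola.\<close>

lemma clairaut_normal_form:
  fixes a b c \<alpha> \<beta> x y p :: real
  defines "N \<equiv> \<alpha>^2 + \<beta>^2" and "\<kappa> \<equiv> a * \<beta>^2 - b * \<alpha> * \<beta> + c * \<alpha>^2"
  defines "P \<equiv> 2 * (\<alpha> * x + a) * p + \<beta> * x - \<alpha> * y + b"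
  defines "t \<equiv> (\<alpha> - \<beta> * p) / (\<alpha> * p + \<beta>)"
  defines "X \<equiv> (N * (\<beta> * x + \<alpha> * y) - (b * (\<alpha>^2 - \<beta>^2) + 2 * (c - a) * \<alpha> * \<beta>)) / (2 * \<kappa>)"
  defines "Y \<equiv> (N * (\<alpha> * x - \<beta> * y) + (a * \<alpha>^2 + b * \<alpha> * \<beta> + c * \<beta>^2)) / (2 * \<kappa>)"
  assumes \<kappa>: "\<kappa> \<noteq> 0" and u: "\<alpha> * p + \<beta> \<noteq> 0"
    and eq: "y = x * p + (a * p^2 + b * p + c) / (\<alpha> * p + \<beta>)"
  shows "X - t = N * P / (2 * \<kappa>)" and "t^2 - 2 * t * X + 2 * Y = 0"
proof -
  have e: "(\<alpha> * p + \<beta>) * y = x * p * (\<alpha> * p + \<beta>) + (a * p^2 + b * p + c)"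
    using eq u by (simp add: field_simps)
  have t: "t * (\<alpha> * p + \<beta>) = \<alpha> - \<beta> * p"
    using u by (simp add: t_def)
  have X: "2 * \<kappa> * X = N * (\<beta> * x + \<alpha> * y) - (b * (\<alpha>^2 - \<beta>^2) + 2 * (c - a) * \<alpha> * \<beta>)"
    and Y: "2 * \<kappa> * Y = N * (\<alpha> * x - \<beta> * y) + (a * \<alpha>^2 + b * \<alpha> * \<beta> + c * \<beta>^2)"
    using \<kappa> by (simp_all add: X_def Y_def)
  \<comment> \<open>Multiplication by \<alpha> p + \<beta> clears the denominator of
    \<open>t\<close>. What remains is a polynomial identity modulo the Clairaut equation
    \<open>e\<close>, with an explicit cofactor.\<close>
  have "(\<alpha> * p + \<beta>) * (2 * \<kappa> * X) - 2 * \<kappa> * (t * (\<alpha> * p + \<beta>)) - (\<alpha> * p + \<beta>) * (N * P)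
      = 2 * \<alpha> * N * ((\<alpha> * p + \<beta>) * y - (x * p * (\<alpha> * p + \<beta>) + (a * p^2 + b * p + c)))"
    unfolding X t unfolding P_def N_def \<kappa>_def by (simp add: algebra_simps power2_eq_square)
  also have "\<dots> = 0"
    using e by simp
  finally have "(\<alpha> * p + \<beta>) * (2 * \<kappa> * (X - t)) = (\<alpha> * p + \<beta>) * (N * P)"
    by (simp add: algebra_simps)
  then have "2 * \<kappa> * (X - t) = N * P"
    using u by simp
  then show "X - t = N * P / (2 * \<kappa>)"
    using \<kappa> by (simp add: field_simps)
  \<comment> \<open>The same method for the quadratic equation, now multiplied by the square of
    \<alpha> p + \<beta>; the cofactor of the Clairaut equation is \<open>- (N^2)\<close>.\<close>
  have "\<kappa> * (t * (\<alpha> * p + \<beta>))^2 - (\<alpha> * p + \<beta>) * (t * (\<alpha> * p + \<beta>)) * (2 * \<kappa> * X)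
        + (\<alpha> * p + \<beta>)^2 * (2 * \<kappa> * Y)
      = - (N^2) * ((\<alpha> * p + \<beta>) * y - (x * p * (\<alpha> * p + \<beta>) + (a * p^2 + b * p + c)))"
    unfolding X Y t unfolding N_def \<kappa>_def by (simp add: algebra_simps power2_eq_square)
  moreover have "\<kappa> * (t * (\<alpha> * p + \<beta>))^2 - (\<alpha> * p + \<beta>) * (t * (\<alpha> * p + \<beta>)) * (2 * \<kappa> * X)
        + (\<alpha> * p + \<beta>)^2 * (2 * \<kappa> * Y)
      = (\<alpha> * p + \<beta>)^2 * (\<kappa> * (t^2 - 2 * t * X + 2 * Y))"
    by (simp add: algebra_simps power2_eq_square)
  ultimately have "\<kappa> * (t^2 - 2 * t * X + 2 * Y) = 0"
    using e u by simp
  then show "t^2 - 2 * t * X + 2 * Y = 0"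
    using \<kappa> by simp
qed

text \<open>The discriminant locus, where both solutions of the quadratic equation for \<open>f\<close> coincide, is
  the envelope of the lines; \<open>f\<close> cannot be differentiable there, since differentiating
  the equation in the direction of \<open>y\<close> gives \<open>P * f\<^sub>y = \<alpha> * f + \<beta>\<close>, where \<open>P\<close>
  is the expression below.\<close>

lemma clairaut_separant_nonzero:
  fixes f :: "real^2 \<Rightarrow> real"
  assumes "open U" "q \<in> U" "f differentiable (at q)"
    and u: "\<And>p. p \<in> U \<Longrightarrow> \<alpha> * f p + \<beta> \<noteq> 0"
    and eq: "\<And>p. p \<in> U \<Longrightarrow> p $ 2 = p $ 1 * f p + (a * (f p)^2 + b * f p + c) / (\<alpha> * f p + \<beta>)"
  shows "2 * (\<alpha> * q $ 1 + a) * f q + \<beta> * q $ 1 - \<alpha> * q $ 2 + b \<noteq> 0"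
proof
  assume 0: "2 * (\<alpha> * q $ 1 + a) * f q + \<beta> * q $ 1 - \<alpha> * q $ 2 + b = 0"
  \<comment> \<open>\<open>E\<close> is the Clairaut equation with the denominator cleared, ordered
    as a quadratic polynomial in \<open>f p\<close>. It vanishes on \<open>U\<close>, and its
    derivative with respect to the value of \<open>f\<close> is the expression assumed to be 0 at
    \<open>q\<close>.\<close>
  define E where "E p = (\<alpha> * p $ 1 + a) * (f p * f p) + (\<beta> * p $ 1 - \<alpha> * p $ 2 + b) * f p
    + (c - \<beta> * p $ 2)" for p :: "real^2"
  obtain f' where f': "(f has_derivative f') (at q)"
    using assms(3) by (auto simp: differentiable_def)
  have nth: "((\<lambda>p::real^2. p $ i) has_derivative (\<lambda>w. w $ i)) (at q)" for i
    by (rule bounded_linear_imp_has_derivative[OF bounded_linear_vec_nth])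
  have "(E has_derivative (\<lambda>w. (2 * (\<alpha> * q $ 1 + a) * f q + \<beta> * q $ 1 - \<alpha> * q $ 2 + b) * f' w
      + \<alpha> * w $ 1 * (f q)^2 + (\<beta> * w $ 1 - \<alpha> * w $ 2) * f q - \<beta> * w $ 2)) (at q)"
    unfolding E_def
    by (auto intro!: derivative_eq_intros nth f' simp: algebra_simps power2_eq_square fun_eq_iff)
  moreover have "(E has_derivative (\<lambda>w. 0)) (at q)"
  proof (rule has_derivative_transform_within_open[OF has_derivative_const[of 0] assms(1,2)])
    show "0 = E p" if "p \<in> U" for p
      using eq[OF that] u[OF that] unfolding E_def by (simp add: field_simps power2_eq_square)
  qed
  ultimately have "(\<lambda>w. (2 * (\<alpha> * q $ 1 + a) * f q + \<beta> * q $ 1 - \<alpha> * q $ 2 + b) * f' w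
      + \<alpha> * w $ 1 * (f q)^2 + (\<beta> * w $ 1 - \<alpha> * w $ 2) * f q - \<beta> * w $ 2) = (\<lambda>w. 0)"
    by (rule has_derivative_unique)
  from fun_cong[OF this[unfolded 0], of "axis 2 1"] have "\<alpha> * f q + \<beta> = 0"
    by (simp add: axis_def)
  with u[OF assms(2)] show False by simp
qed

text \<open>The image of \<open>U\<close> is an interval that misses 0. The sign is returned as a
  factor because it becomes the reflection in the final affine map.\<close>

lemma connected_continuous_constant_sign:
  fixes h :: "'a::topological_space \<Rightarrow> real"
  assumes "connected U" "continuous_on U h" "\<And>p. p \<in> U \<Longrightarrow> h p \<noteq> 0"
  obtains s :: real where "s = 1 \<or> s = - 1" "\<And>p. p \<in> U \<Longrightarrow> s * h p > 0"
proof -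
  have "connected (h ` U)"
    by (rule connected_continuous_image[OF assms(2,1)])
  moreover have "0 \<notin> h ` U" using assms(3) by force
  ultimately have same: "h p > 0 \<longleftrightarrow> h q > 0" if "p \<in> U" "q \<in> U" for p q
    using that unfolding connected_iff_interval by (meson imageI linorder_not_less order_less_imp_le)
  show thesis
  proof (cases "\<forall>p\<in>U. h p > 0")
    case True
    then show ?thesis using that[of 1] by simp
  next
    case False
    then have "h p < 0" if "p \<in> U" for p
      using same that assms(3) by (meson linorder_neqE_linordered_idom)
    then show ?thesis using that[of "- 1"] by simp
  qed
qed

section \<open>Line fields and affine maps\<close>

lemma frechet_derivative_aff_map: "frechet_derivative (aff_map g) (at p) = (*v) (fst g)"
proof -
  have "bounded_linear ((*v) (fst g))"
    by (simp add: linear_conv_bounded_linear[symmetric])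
  then have "(aff_map g has_derivative (*v) (fst g)) (at p)"
    unfolding aff_map_def[abs_def]
    by (auto intro!: derivative_eq_intros bounded_linear.has_derivative[where f = "(*v) (fst g)"])
  then show ?thesis by (rule frechet_derivative_at[symmetric])
qed

lemma line_field_eq_range: "line_field f p = range (\<lambda>r. r *\<^sub>R vector [1, f p])"
proof -
  have "v = (v $ 1) *\<^sub>R vector [1, f p]" if "v $ 2 = f p * v $ 1" for v :: "real^2"
    using that by (simp add: vec_eq_iff forall_2)
  then show ?thesis
    by (auto simp: line_field_def)
qed

text \<open>Each line is spanned by the vector with entries 1 and the slope, so it suffices to
  follow this vector up to a nonzero factor.\<close>

lemma matrix_image_line_field:
  fixes A :: "real^2^2"
  assumes "A *v vector [1, f p] = k *\<^sub>R vector [1, F q]" "k \<noteq> 0"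
  shows "(*v) A ` line_field f p = line_field F q"
proof -
  have "(*v) A ` line_field f p = range (\<lambda>r. (r * k) *\<^sub>R vector [1, F q])"
    unfolding line_field_eq_range image_image
    by (simp add: matrix_vector_mult_scaleR assms(1))
  also have "\<dots> = (\<lambda>r. r *\<^sub>R vector [1, F q]) ` range (\<lambda>r. r * k)"
    by (simp add: image_image)
  also have "range (\<lambda>r. r * k) = UNIV"
    using assms(2) by (intro surjI[where f = "\<lambda>r. r / k"]) simp
  finally show ?thesis by (simp add: line_field_eq_range)
qed

section \<open>The symmetry group of the model equation\<close>

text \<open>With \<open>s = (ln l, m)\<close> this is the map \<open>(x, y) \<mapsto> (l x + m, l\<^sup>2 y + l m x + m\<^sup>2/2)\<close>.\<close>

definition parabola_aff :: "real^2 \<Rightarrow> aff" where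
  "parabola_aff s = (vector [vector [exp (s $ 1), 0], vector [exp (s $ 1) * s $ 2, exp (s $ 1) * exp (s $ 1)]],
     vector [s $ 2, s $ 2 * s $ 2 * (1 / 2)])"

text \<open>The group law of the affine maps t -> l t + m of the line, which describe the action on
  slopes of tangents, in the coordinates ln l and m. The logarithm makes the whole plane a global
  chart.\<close>

definition parabola_mult :: "(real^2) \<times> (real^2) \<Rightarrow> real^2" where
  "parabola_mult z = vector [fst z $ 1 + snd z $ 1, exp (fst z $ 1) * snd z $ 2 + fst z $ 2]"

definition parabola_inverse :: "real^2 \<Rightarrow> real^2" where
  "parabola_inverse s = vector [- (s $ 1), exp (- (s $ 1)) * (- (s $ 2))]"

lemma parabola_aff_mult:
  "parabola_aff s \<otimes>\<^bsub>A2\<^esub> parabola_aff t = parabola_aff (parabola_mult (s, t))"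
  by (simp add: A2_def parabola_aff_def parabola_mult_def vec_eq_iff forall_2 sum_2
      matrix_matrix_mult_def matrix_vector_mult_def exp_add algebra_simps)

lemma parabola_aff_0: "parabola_aff 0 = \<one>\<^bsub>A2\<^esub>"
  by (simp add: A2_def parabola_aff_def vec_eq_iff forall_2 mat_def)

lemma parabola_mult_inverse: "parabola_mult (parabola_inverse s, s) = 0"
  by (simp add: parabola_mult_def parabola_inverse_def vec_eq_iff forall_2)

lemma parabola_aff_in_A2: "parabola_aff s \<in> carrier A2"
  by (simp add: A2_def parabola_aff_def invertible_det_nz det_2)

lemma inv_parabola_aff: "inv\<^bsub>A2\<^esub> parabola_aff s = parabola_aff (parabola_inverse s)"
  by (rule group.inv_equality[OF group_A2])
    (simp_all add: parabola_aff_mult parabola_mult_inverse parabola_aff_0 parabola_aff_in_A2)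

lemma smooth_parabola_mult: "smooth_on UNIV parabola_mult"
  unfolding smooth_on_def parabola_mult_def[abs_def]
  by (intro allI Ck_on_vector_2 Ck_on_intros open_UNIV)

lemma smooth_parabola_inverse: "smooth_on UNIV parabola_inverse"
  unfolding smooth_on_def parabola_inverse_def[abs_def]
  by (intro allI Ck_on_vector_2 Ck_on_intros open_UNIV)

lemma smooth_parabola_aff: "smooth_on UNIV parabola_aff"
  unfolding smooth_on_def parabola_aff_def[abs_def]
  by (intro allI Ck_on_vector_2 Ck_on_intros open_UNIV)

section \<open>Conjugation in the affine group, and the symmetries of the model equation\<close>

text \<open>For fixed \<open>g\<close> and \<open>h\<close> the map k -> h k g is affine on the
  vector space of pairs, and this is its linear part. Smoothness and differentiation of conjugated
  charts rest on it.\<close>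

lemma bounded_linear_conjugation:
  fixes g h :: aff
  shows "bounded_linear (\<lambda>k. (fst h ** fst k ** fst g, fst h *v (fst k *v snd g + snd k)))"
proof -
  have "linear (\<lambda>k::aff. (fst h ** fst k ** fst g, fst h *v (fst k *v snd g + snd k)))"
    by (rule linearI) (simp_all add: prod_eq_iff vec_eq_iff forall_2 sum_2
        matrix_matrix_mult_def matrix_vector_mult_def algebra_simps)
  then show ?thesis by (simp add: linear_conv_bounded_linear)
qed

lemma conjugation_eq:
  fixes g h k :: aff
  shows "h \<otimes>\<^bsub>A2\<^esub> k \<otimes>\<^bsub>A2\<^esub> g
    = (fst h ** fst k ** fst g, fst h *v (fst k *v snd g + snd k)) + (0, snd h)"
  by (simp add: A2_def matrix_vector_mul_assoc matrix_vector_right_distrib)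

lemma smooth_conjugation:
  assumes "smooth_on S \<phi>" "open S"
  shows "smooth_on S (\<lambda>s. h \<otimes>\<^bsub>A2\<^esub> \<phi> s \<otimes>\<^bsub>A2\<^esub> g)"
  using assms unfolding smooth_on_def conjugation_eq
  by (intro allI Ck_on_add Ck_on_const Ck_on_bounded_linear[OF bounded_linear_conjugation]) auto

text \<open>Two entries suffice: the upper left matrix entry has derivative
  \<open>exp (s $ 1) * v $ 1\<close>, and the first translation component has derivative
  \<open>v $ 2\<close>.\<close>

lemma inj_frechet_derivative_parabola_aff: "inj (frechet_derivative parabola_aff (at s))"
proof (rule injI)
  let ?D = "frechet_derivative parabola_aff (at s)"
  fix v w assume eq: "?D v = ?D w"
  have D: "(parabola_aff has_derivative ?D) (at s)"
    by (rule smooth_on_imp_has_derivative[OF smooth_parabola_aff]) simp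
  have nth: "((\<lambda>p::real^2. p $ i) has_derivative (\<lambda>w. w $ i)) (at s)" for i
    by (rule bounded_linear_imp_has_derivative[OF bounded_linear_vec_nth])
  have "((\<lambda>s. fst (parabola_aff s) $ 1 $ 1) has_derivative (\<lambda>v. fst (?D v) $ 1 $ 1)) (at s)"
    by (intro bounded_linear.has_derivative[OF bounded_linear_vec_nth] has_derivative_fst D)
  moreover have "((\<lambda>s. fst (parabola_aff s) $ 1 $ 1) has_derivative (\<lambda>v. exp (s $ 1) * v $ 1)) (at s)"
    unfolding parabola_aff_def by (auto intro!: derivative_eq_intros nth)
  ultimately have "(\<lambda>v. fst (?D v) $ 1 $ 1) = (\<lambda>v. exp (s $ 1) * v $ 1)"
    by (rule has_derivative_unique)
  then have 1: "v $ 1 = w $ 1"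
    using eq by (metis exp_not_eq_zero mult_left_cancel)
  have "((\<lambda>s. snd (parabola_aff s) $ 1) has_derivative (\<lambda>v. snd (?D v) $ 1)) (at s)"
    by (intro bounded_linear.has_derivative[OF bounded_linear_vec_nth] has_derivative_snd D)
  moreover have "((\<lambda>s. snd (parabola_aff s) $ 1) has_derivative (\<lambda>v. v $ 2)) (at s)"
    unfolding parabola_aff_def by (auto intro!: derivative_eq_intros nth)
  ultimately have "(\<lambda>v. snd (?D v) $ 1) = (\<lambda>v. v $ 2)"
    by (rule has_derivative_unique)
  then have "v $ 2 = w $ 2"
    using eq by metis
  with 1 show "v = w" by (simp add: vec_eq_iff forall_2)
qed

lemma inj_parabola_aff: "inj parabola_aff"
  by (rule injI) (simp add: parabola_aff_def vec_eq_iff forall_2)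

lemma conjugate_back:
  assumes g: "g \<in> carrier A2" and k: "k \<in> carrier A2"
  shows "g \<otimes>\<^bsub>A2\<^esub> (inv\<^bsub>A2\<^esub> g \<otimes>\<^bsub>A2\<^esub> k \<otimes>\<^bsub>A2\<^esub> g) \<otimes>\<^bsub>A2\<^esub> inv\<^bsub>A2\<^esub> g = k"
proof -
  interpret group A2 by (rule group_A2)
  have "g \<otimes>\<^bsub>A2\<^esub> (inv\<^bsub>A2\<^esub> g \<otimes>\<^bsub>A2\<^esub> k \<otimes>\<^bsub>A2\<^esub> g) = k \<otimes>\<^bsub>A2\<^esub> g"
    using g k by (simp add: m_assoc[symmetric])
  then show ?thesis using g k by (simp add: m_assoc)
qed

text \<open>Conjugation is a homomorphism, so the operations keep the coordinate expressions
  \<open>parabola_mult\<close> and \<open>parabola_inverse\<close>. Undoing the conjugation gives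
  injectivity of the chart and of its derivative.\<close>

lemma lie_subgroup_A2_conjugate_parabola_aff:
  assumes g: "g \<in> carrier A2"
  shows "lie_subgroup_A2 TYPE(real^2)
    (range (\<lambda>s. inv\<^bsub>A2\<^esub> g \<otimes>\<^bsub>A2\<^esub> parabola_aff s \<otimes>\<^bsub>A2\<^esub> g))"
proof (rule lie_subgroup_A2_global_chart[OF _ _ _ smooth_parabola_mult _ smooth_parabola_inverse])
  interpret group A2 by (rule group_A2)
  let ?\<phi> = "\<lambda>s. inv\<^bsub>A2\<^esub> g \<otimes>\<^bsub>A2\<^esub> parabola_aff s \<otimes>\<^bsub>A2\<^esub> g"
  note in_A2 = parabola_aff_in_A2
  have unconj: "g \<otimes>\<^bsub>A2\<^esub> ?\<phi> s \<otimes>\<^bsub>A2\<^esub> inv\<^bsub>A2\<^esub> g = parabola_aff s" for s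
    by (rule conjugate_back[OF g in_A2])
  show "inj ?\<phi>"
    by (rule inj_on_inverseI[where g = "\<lambda>k. inv_into UNIV parabola_aff (g \<otimes>\<^bsub>A2\<^esub> k \<otimes>\<^bsub>A2\<^esub> inv\<^bsub>A2\<^esub> g)"])
      (simp add: unconj inj_parabola_aff)
  show "range ?\<phi> \<subseteq> carrier A2"
    using g in_A2 by auto
  show "?\<phi> s \<otimes>\<^bsub>A2\<^esub> ?\<phi> t = ?\<phi> (parabola_mult (s, t))" for s t
  proof -
    have "parabola_aff s \<otimes>\<^bsub>A2\<^esub> g \<otimes>\<^bsub>A2\<^esub> ?\<phi> t
        = parabola_aff s \<otimes>\<^bsub>A2\<^esub> (g \<otimes>\<^bsub>A2\<^esub> inv\<^bsub>A2\<^esub> g) \<otimes>\<^bsub>A2\<^esub> (parabola_aff t \<otimes>\<^bsub>A2\<^esub> g)"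
      using g in_A2 by (simp only: m_assoc m_closed inv_closed)
    then have "?\<phi> s \<otimes>\<^bsub>A2\<^esub> ?\<phi> t
        = inv\<^bsub>A2\<^esub> g \<otimes>\<^bsub>A2\<^esub> (parabola_aff s \<otimes>\<^bsub>A2\<^esub> parabola_aff t) \<otimes>\<^bsub>A2\<^esub> g"
      using g in_A2 by (simp add: m_assoc)
    then show ?thesis by (simp only: parabola_aff_mult)
  qed
  show "inv\<^bsub>A2\<^esub> ?\<phi> s = ?\<phi> (parabola_inverse s)" for s
    using g in_A2 by (simp add: inv_mult_group m_assoc flip: inv_parabola_aff)
  show smooth: "smooth_on UNIV ?\<phi>"
    by (rule smooth_conjugation[OF smooth_parabola_aff]) simp
  show "inj (frechet_derivative ?\<phi> (at s))" for s
  proof -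
    let ?L = "\<lambda>k::aff. (fst g ** fst k ** fst (inv\<^bsub>A2\<^esub> g), fst g *v (fst k *v snd (inv\<^bsub>A2\<^esub> g) + snd k))"
    let ?D = "frechet_derivative ?\<phi> (at s)"
    \<comment> \<open>The map differentiated here is \<open>parabola_aff\<close> itself, recovered
      from \<open>?\<phi>\<close> by the reverse conjugation. Its derivative factors through
      \<open>?D\<close> and is injective, hence so is \<open>?D\<close>.\<close>
    have "((\<lambda>s. ?L (?\<phi> s) + (0, snd g)) has_derivative (\<lambda>v. ?L (?D v) + 0)) (at s)"
      by (intro has_derivative_add has_derivative_const
          bounded_linear.has_derivative[OF bounded_linear_conjugation]
          smooth_on_imp_has_derivative[OF smooth]) simp
    then have "(parabola_aff has_derivative (\<lambda>v. ?L (?D v))) (at s)"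
      unfolding conjugation_eq[symmetric] unconj by simp
    then have "(\<lambda>v. ?L (?D v)) = frechet_derivative parabola_aff (at s)"
      by (rule frechet_derivative_at)
    then have "inj (?L \<circ> ?D)"
      using inj_frechet_derivative_parabola_aff[of s] by (simp add: o_def)
    then show ?thesis by (rule inj_on_imageI2)
  qed
qed

text \<open>The map multiplies the discriminant \<open>D\<close> by l^2, where l =
  \<open>exp (s $ 1)\<close>. Since l is positive, the root is multiplied by l, so the smaller slope
  goes to the smaller slope.\<close>

lemma parabola_aff_line_field:
  fixes p :: "real^2" and s :: "real^2"
  defines "D \<equiv> \<lambda>p::real^2. (p $ 1)^2 - 2 * p $ 2"
    and "F \<equiv> \<lambda>p::real^2. p $ 1 - sqrt ((p $ 1)^2 - 2 * p $ 2)"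
  assumes "D p > 0"
  shows "(*v) (fst (parabola_aff s)) ` line_field F p = line_field F (aff_map (parabola_aff s) p)"
proof (rule matrix_image_line_field)
  let ?q = "aff_map (parabola_aff s) p" and ?l = "exp (s $ 1)"
  have q: "?q $ 1 = ?l * p $ 1 + s $ 2"
      "?q $ 2 = ?l * s $ 2 * p $ 1 + ?l^2 * p $ 2 + (s $ 2)^2 / 2"
    by (simp_all add: aff_map_def parabola_aff_def matrix_vector_mult_def sum_2 power2_eq_square)
  have "(?q $ 1)^2 - 2 * ?q $ 2 = ?l^2 * D p"
    unfolding q D_def by (simp add: power2_eq_square algebra_simps)
  then have "sqrt ((?q $ 1)^2 - 2 * ?q $ 2) = ?l * sqrt (D p)"
    by (simp add: real_sqrt_mult)
  then have "F ?q = ?l * F p + s $ 2"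
    unfolding F_def D_def q by (simp add: algebra_simps)
  then show "fst (parabola_aff s) *v vector [1, F p] = ?l *\<^sub>R vector [1, F ?q]"
    by (simp add: parabola_aff_def vec_eq_iff forall_2 matrix_vector_mult_def sum_2 algebra_simps)
qed simp

text \<open>From g h = k g, the lines of \<open>f\<close> at \<open>p\<close> are pushed to
  \<open>U'\<close> by \<open>g\<close>, moved there by the symmetry \<open>k\<close>, and compared
  with the image of the line at h(p). Injectivity of the linear part of \<open>g\<close> cancels
  it.\<close>

lemma admits_conjugate:
  assumes g: "g \<in> carrier A2" and A: "admits U' F H" and H: "H \<subseteq> carrier A2"
    and V: "aff_map g ` U \<subseteq> U'"
    and lf: "\<And>p. p \<in> U \<Longrightarrow> (*v) (fst g) ` line_field f p = line_field F (aff_map g p)"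
  shows "admits U f ((\<lambda>k. inv\<^bsub>A2\<^esub> g \<otimes>\<^bsub>A2\<^esub> k \<otimes>\<^bsub>A2\<^esub> g) ` H)"
proof -
  interpret group A2 by (rule group_A2)
  have mult: "(*v) (fst (x \<otimes>\<^bsub>A2\<^esub> y)) = (*v) (fst x) \<circ> (*v) (fst y)" for x y :: aff
    by (simp add: A2_def fun_eq_iff matrix_vector_mul_assoc)
  have "(*v) (fst h) ` line_field f p = line_field f (aff_map h p)"
    if k: "k \<in> H" and h: "h = inv\<^bsub>A2\<^esub> g \<otimes>\<^bsub>A2\<^esub> k \<otimes>\<^bsub>A2\<^esub> g"
      and p: "p \<in> U" "aff_map h p \<in> U" for k h p
  proof -
    have kA: "k \<in> carrier A2" using k H by auto
    have gh: "g \<otimes>\<^bsub>A2\<^esub> h = k \<otimes>\<^bsub>A2\<^esub> g"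
      using g kA unfolding h by (simp add: m_assoc[symmetric])
    then have ghp: "aff_map g (aff_map h p) = aff_map k (aff_map g p)"
      by (metis aff_map_mult comp_apply)
    have "(*v) (fst g) ` ((*v) (fst h) ` line_field f p) = (*v) (fst k) ` ((*v) (fst g) ` line_field f p)"
      by (simp only: image_comp mult[symmetric] gh)
    also have "\<dots> = line_field F (aff_map k (aff_map g p))"
    proof -
      have "aff_map g p \<in> U'" "aff_map k (aff_map g p) \<in> U'"
        using V p by (simp_all add: ghp[symmetric] image_subset_iff)
      then show ?thesis
        using A k by (simp add: lf[OF p(1)] admits_def frechet_derivative_aff_map)
    qed
    also have "\<dots> = (*v) (fst g) ` line_field f (aff_map h p)"
      unfolding ghp[symmetric] lf[OF p(2)] ..
    finally have "(*v) (fst g) ` ((*v) (fst h) ` line_field f p) = (*v) (fst g) ` line_field f (aff_map h p)" .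
    moreover have "inj ((*v) (fst g))"
      using g by (simp add: A2_def inj_matrix_vector_mult)
    ultimately show ?thesis
      by (simp only: inj_image_eq_iff)
  qed
  then show ?thesis
    unfolding admits_def frechet_derivative_aff_map by (auto simp del: image_image)
qed

theorem theorem4p3:
  fixes a b c \<alpha> \<beta> :: real and U :: "(real^2) set" and f :: "real^2 \<Rightarrow> real"
  assumes "a * \<beta>^2 - b * \<alpha> * \<beta> + c * \<alpha>^2 \<noteq> 0"
    and "U \<noteq> {}" and "connected U" and "open U"
    and "smooth_on U f"
    and "\<forall>p\<in>U. \<alpha> * f p + \<beta> \<noteq> 0"
    and "\<forall>p\<in>U. p $ 2 = p $ 1 * f p + (a * (f p)^2 + b * f p + c) / (\<alpha> * f p + \<beta>)"
  shows "(\<exists>H. lie_subgroup_A2 TYPE(real^2) H \<and> admits U f H) \<and>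
         transformable U f {p. (p $ 1)^2 - 2 * p $ 2 > 0}
           (\<lambda>p. p $ 1 - sqrt ((p $ 1)^2 - 2 * p $ 2))"
proof -
  let ?U' = "{p::real^2. (p $ 1)^2 - 2 * p $ 2 > 0}"
  let ?F = "\<lambda>p::real^2. p $ 1 - sqrt ((p $ 1)^2 - 2 * p $ 2)"
  define N where "N = \<alpha>^2 + \<beta>^2"
  define \<kappa> where "\<kappa> = a * \<beta>^2 - b * \<alpha> * \<beta> + c * \<alpha>^2"
  define P where "P q = 2 * (\<alpha> * q $ 1 + a) * f q + \<beta> * q $ 1 - \<alpha> * q $ 2 + b" for q :: "real^2"
  have \<kappa>: "\<kappa> \<noteq> 0" using assms(1) by (simp add: \<kappa>_def)
  \<comment> \<open>If \<alpha> and \<beta> were both 0, then \<kappa> would be 0.\<close>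
  then have N: "N > 0" by (auto simp: \<kappa>_def N_def sum_power2_gt_zero_iff)
  have cont: "continuous_on U f" using assms(5) by (rule smooth_on_imp_continuous_on)
  have diff: "f differentiable (at q)" if "q \<in> U" for q
    using assms(5) that unfolding smooth_on_def by (metis Ck_on.simps(2))
  \<comment> \<open>By \<open>clairaut_normal_form\<close> this quantity is X - t, and its sign
    tells whether t is the smaller or the larger root, that is, which tangent \<open>f\<close>
    selects.\<close>
  have "N * P q / (2 * \<kappa>) \<noteq> 0" if "q \<in> U" for q
    using clairaut_separant_nonzero[OF assms(4) that diff[OF that], of \<alpha> \<beta> a b c] assms(6,7) N \<kappa>
    by (simp add: P_def)
  moreover have "continuous_on U (\<lambda>q. N * P q / (2 * \<kappa>))"
    unfolding P_def by (intro continuous_intros cont) (use \<kappa> in auto)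
  ultimately obtain \<epsilon> :: real where \<epsilon>: "\<epsilon> = 1 \<or> \<epsilon> = - 1" "\<And>q. q \<in> U \<Longrightarrow> \<epsilon> * (N * P q / (2 * \<kappa>)) > 0"
    using connected_continuous_constant_sign[OF assms(3)] by blast
  then have \<epsilon>2: "\<epsilon> * \<epsilon> = 1" by auto
  \<comment> \<open>The constants are read off from \<open>X\<close> and \<open>Y\<close> in
    \<open>clairaut_normal_form\<close>, so that \<open>g\<close> maps a point to (\<epsilon> X, Y).
    The factor \<epsilon> reflects the first coordinate when t is the larger root.\<close>
  define m where "m = N / (2 * \<kappa>)"
  define B where "B = (b * (\<alpha>^2 - \<beta>^2) + 2 * (c - a) * \<alpha> * \<beta>) / (2 * \<kappa>)"
  define A where "A = (a * \<alpha>^2 + b * \<alpha> * \<beta> + c * \<beta>^2) / (2 * \<kappa>)"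
  have m: "m \<noteq> 0" using N \<kappa> by (simp add: m_def)
  define g :: aff where
    "g = (vector [vector [\<epsilon> * m * \<beta>, \<epsilon> * m * \<alpha>], vector [m * \<alpha>, - (m * \<beta>)]], vector [- (\<epsilon> * B), A])"
  have "det (fst g) = - (\<epsilon> * m^2 * N)"
    by (simp add: g_def det_2 N_def power2_eq_square algebra_simps)
  then have g: "g \<in> carrier A2"
    using N m \<epsilon>(1) by (auto simp: A2_def invertible_det_nz)
  have key: "aff_map g q \<in> ?U' \<and> (*v) (fst g) ` line_field f q = line_field ?F (aff_map g q)"
    if q: "q \<in> U" for q
  proof -
    define X where "X = (N * (\<beta> * q $ 1 + \<alpha> * q $ 2) - (b * (\<alpha>^2 - \<beta>^2) + 2 * (c - a) * \<alpha> * \<beta>)) / (2 * \<kappa>)"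
    define Y where "Y = (N * (\<alpha> * q $ 1 - \<beta> * q $ 2) + (a * \<alpha>^2 + b * \<alpha> * \<beta> + c * \<beta>^2)) / (2 * \<kappa>)"
    define t where "t = (\<alpha> - \<beta> * f q) / (\<alpha> * f q + \<beta>)"
    have u: "\<alpha> * f q + \<beta> \<noteq> 0" using assms(6) q by blast
    have "q $ 2 = q $ 1 * f q + (a * (f q)^2 + b * f q + c) / (\<alpha> * f q + \<beta>)"
      using assms(7) q by blast
    note nf = clairaut_normal_form[OF assms(1) u this, folded N_def \<kappa>_def, folded X_def Y_def t_def P_def]
    have X: "X = m * (\<beta> * q $ 1 + \<alpha> * q $ 2) - B" and Y: "Y = m * (\<alpha> * q $ 1 - \<beta> * q $ 2) + A"
      by (simp_all add: X_def Y_def m_def A_def B_def diff_divide_distrib add_divide_distrib)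
    have gq: "aff_map g q $ 1 = \<epsilon> * X" "aff_map g q $ 2 = Y"
      unfolding X Y by (simp_all add: aff_map_def g_def matrix_vector_mult_def sum_2 algebra_simps)
    have pos: "\<epsilon> * (X - t) > 0"
      using \<epsilon>(2)[OF q] nf(1) by simp
    \<comment> \<open>As t is a root of the quadratic equation, completing the square turns the
      discriminant into (X - t)^2.\<close>
    have sq: "(\<epsilon> * X)^2 - 2 * Y = (\<epsilon> * (X - t))^2"
    proof -
      have "X^2 - 2 * Y = (X - t)^2"
        using nf(2) by (simp add: power2_eq_square algebra_simps)
      moreover have "\<epsilon>^2 = 1" using \<epsilon>2 by (simp add: power2_eq_square)
      ultimately show ?thesis by (simp add: power_mult_distrib)
    qed
    \<comment> \<open>Positivity of \<epsilon> (X - t) identifies it with the square root, and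
      subtracting it from \<epsilon> X leaves \<epsilon> t.\<close>
    have F: "?F (aff_map g q) = \<epsilon> * t"
      unfolding gq sq using pos by (simp add: right_diff_distrib)
    have "\<epsilon> * m * (\<alpha> * f q + \<beta>) * (\<epsilon> * t) = (\<epsilon> * \<epsilon>) * m * (t * (\<alpha> * f q + \<beta>))"
      by (simp only: ac_simps)
    also have "\<dots> = m * (\<alpha> - \<beta> * f q)"
      using u by (simp add: \<epsilon>2 t_def)
    finally have "fst g *v vector [1, f q] = (\<epsilon> * m * (\<alpha> * f q + \<beta>)) *\<^sub>R vector [1, \<epsilon> * t]"
      by (simp add: g_def vec_eq_iff forall_2 matrix_vector_mult_def sum_2 algebra_simps)
    then have "(*v) (fst g) ` line_field f q = line_field ?F (aff_map g q)"
      unfolding F[symmetric] by (rule matrix_image_line_field) (use \<epsilon>(1) u m in auto)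
    moreover have "(\<epsilon> * X)^2 - 2 * Y > 0"
      unfolding sq using pos by (rule zero_less_power)
    ultimately show ?thesis
      by (simp add: gq)
  qed
  have "admits ?U' ?F (range parabola_aff)"
    unfolding admits_def frechet_derivative_aff_map using parabola_aff_line_field by auto
  then have "admits U f ((\<lambda>k. inv\<^bsub>A2\<^esub> g \<otimes>\<^bsub>A2\<^esub> k \<otimes>\<^bsub>A2\<^esub> g) ` range parabola_aff)"
    using key parabola_aff_in_A2 by (intro admits_conjugate[OF g]) auto
  then have "\<exists>H. lie_subgroup_A2 TYPE(real^2) H \<and> admits U f H"
    using lie_subgroup_A2_conjugate_parabola_aff[OF g] by (auto simp: image_image)
  \<comment> \<open>The map \<open>g\<close> does not depend on the point, so \<open>U\<close>
    itself serves as the neighbourhood.\<close>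
  moreover have "transformable U f ?U' ?F"
    unfolding transformable_def frechet_derivative_aff_map using key g assms(4) by blast
  ultimately show ?thesis by blast
qed

end
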